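(* A real Banach space $\mathbb{X}$ is smooth if and only if for every $T \in \mathbb{L}(\mathbb{X})$ and for every $x \in M_T$, we have $T(x^{\perp}) \subseteq (Tx)^{\perp}$.
   Context: $\mathbb{L}(\mathbb{X})$ is the space of bounded linear operators on $\mathbb{X}$. $S_{\mathbb{X}} = \{x \in \mathbb{X} : \|x\| = 1\}$ and $M_T = \{x \in S_{\mathbb{X}} : \|Tx\| = \|T\|\}$. For $x,y \in \mathbb{X}$, $x \perp_B y$ (Birkhoff-James orthogonality) means $\|x\| \le \|x + \lambda y\|$ for all $\lambda \in \mathbb{R}$, and $x^{\perp} = \{y \in \mathbb{X} : x \perp_B y\}$. A Banach space is smooth if each point $x$ of its unit sphere has a unique norm-one functional $f$ with $f(x) = 1$. *)

theory Defs
  imports "HOL-Analysis.Analysis"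
begin

definition birkhoff_james_orthogonal :: "'a::real_normed_vector \<Rightarrow> 'a \<Rightarrow> bool"
    (infix \<open>\<bottom>\<^sub>B\<close> 50) where
  "x \<bottom>\<^sub>B y \<longleftrightarrow> (\<forall>c::real. norm x \<le> norm (x + c *\<^sub>R y))"

text \<open>The orthogonality relation is not symmetric: \<open>x\<close> stands on the left.\<close>

definition bj_perp :: "'a::real_normed_vector \<Rightarrow> 'a set" where
  "bj_perp x = {y. x \<bottom>\<^sub>B y}"

definition norm_attainment_set ::
    "('a::real_normed_vector \<Rightarrow>\<^sub>L 'b::real_normed_vector) \<Rightarrow> 'a set" where
  "norm_attainment_set T = {x \<in> sphere 0 1. norm (blinfun_apply T x) = norm T}"

text \<open>The space is represented by its type; functionals are elements of the dual
  \<open>'a \<Rightarrow>\<^sub>L real\<close>, whose norm is the operator norm.\<close>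

definition smooth_space :: "'a::real_normed_vector itself \<Rightarrow> bool" where
  "smooth_space _ \<longleftrightarrow>
     (\<forall>x \<in> sphere (0::'a) 1. \<exists>!f :: 'a \<Rightarrow>\<^sub>L real. norm f = 1 \<and> blinfun_apply f x = 1)"

end

theory Submission
  imports Defs
begin

text \<open>
  Everything rests on James's dual description of orthogonality: for \<open>x \<noteq> 0\<close>, the relation
  \<open>x \<bottom>\<^sub>B y\<close> holds exactly when some norm-one functional that supports the unit ball in
  the direction of \<open>x\<close> vanishes at \<open>y\<close> (\<open>birkhoff_james_iff_support_functional\<close>).

  If the space is smooth and a nonzero \<open>T\<close> attains its norm at \<open>x\<close>, take a support functional \<open>g\<close> at
  \<open>T x\<close>. The pullback of \<open>g\<close> along \<open>T\<close>, divided by the norm of \<open>T\<close>, is a support functional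
  at \<open>x\<close>, and by smoothness it is the only one. Hence, if \<open>x \<bottom>\<^sub>B y\<close>, it is the one that
  vanishes at \<open>y\<close>; so \<open>g\<close> vanishes at \<open>T y\<close> and \<open>T x \<bottom>\<^sub>B T y\<close>.

  Conversely, let \<open>f\<close> and \<open>g\<close> be distinct support functionals at a unit vector \<open>x\<close>. Some \<open>y\<close>
  lies in the kernel of \<open>f\<close> but not in that of \<open>g\<close>, so \<open>x \<bottom>\<^sub>B y\<close>. The rank-one operator
  \<open>z \<mapsto> g z *\<^sub>R x\<close> has norm one, fixes \<open>x\<close>, and sends \<open>y\<close> to a nonzero multiple of \<open>x\<close>, to which
  \<open>x\<close> is not orthogonal. Orthogonality is therefore not preserved.

  James's description needs the Hahn--Banach theorem. It is obtained here by showing that a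
  minimal sublinear functional is linear: Zorn's lemma applied to the pointwise order then
  yields a linear functional below any given sublinear one.
\<close>

section \<open>Sublinear functionals and the Hahn--Banach theorem\<close>

text \<open>Homogeneity is required as an inequality only, because that is easier to check for
  infima; the equality follows by applying the inequality to the inverse scalar.\<close>

definition sublinear :: "('a::real_vector \<Rightarrow> real) \<Rightarrow> bool" where
  "sublinear p \<longleftrightarrow>
     (\<forall>x y. p (x + y) \<le> p x + p y) \<and> (\<forall>c\<ge>0. \<forall>x. p (c *\<^sub>R x) \<le> c * p x)"

lemma sublinear_add: "sublinear p \<Longrightarrow> p (x + y) \<le> p x + p y"
  by (simp add: sublinear_def)

lemma sublinear_scaleR_le: "sublinear p \<Longrightarrow> c \<ge> 0 \<Longrightarrow> p (c *\<^sub>R x) \<le> c * p x"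
  by (simp add: sublinear_def)

lemma sublinear_zero:
  assumes "sublinear p"
  shows "p 0 = 0"
  using sublinear_add[OF assms, of 0 0] sublinear_scaleR_le[OF assms, of 0 0] by simp

lemma sublinear_scaleR:
  assumes "sublinear p" "c \<ge> 0"
  shows "p (c *\<^sub>R x) = c * p x"
proof (cases "c = 0")
  case True
  then show ?thesis using sublinear_zero[OF assms(1)] by simp
next
  case False
  then have "p x \<le> inverse c * p (c *\<^sub>R x)"
    using sublinear_scaleR_le[OF assms(1), of "inverse c" "c *\<^sub>R x"] assms(2) by simp
  then have "c * p x \<le> p (c *\<^sub>R x)"
    using False assms(2) by (simp add: field_simps)
  then show ?thesis using sublinear_scaleR_le[OF assms, of x] by simp
qed

lemma sublinear_ge_neg:
  assumes "sublinear p"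
  shows "- p (- x) \<le> p x"
  using sublinear_add[OF assms, of x "- x"] sublinear_zero[OF assms] by simp

lemma sublinear_norm: "sublinear norm"
  by (simp add: sublinear_def norm_triangle_ineq)

text \<open>The two conditions on the family are what survives of sublinearity when the index may
  change. This covers infima over chains of sublinear functionals and infima over cones of
  translations alike.\<close>

lemma sublinear_INF:
  assumes ne: "I \<noteq> {}"
    and bdd: "\<And>z. bdd_below ((\<lambda>i. r i z) ` I)"
    and add: "\<And>i j z w. i \<in> I \<Longrightarrow> j \<in> I \<Longrightarrow> \<exists>k\<in>I. r k (z + w) \<le> r i z + r j w"
    and scale: "\<And>i c z. i \<in> I \<Longrightarrow> c \<ge> 0 \<Longrightarrow> \<exists>k\<in>I. r k (c *\<^sub>R z) \<le> c * r i z"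
  shows "sublinear (\<lambda>z. INF i\<in>I. r i z :: real)"
  unfolding sublinear_def
proof (intro conjI allI impI)
  fix z w
  have "(INF i\<in>I. r i (z + w)) - r j w \<le> (INF i\<in>I. r i z)" if "j \<in> I" for j
  proof (rule cINF_greatest[OF ne])
    fix i assume "i \<in> I"
    then obtain k where "k \<in> I" "r k (z + w) \<le> r i z + r j w"
      using add \<open>j \<in> I\<close> by blast
    then show "(INF i\<in>I. r i (z + w)) - r j w \<le> r i z"
      using cINF_lower[OF bdd, of k "z + w"] by simp
  qed
  then have "(INF i\<in>I. r i (z + w)) - (INF i\<in>I. r i z) \<le> (INF j\<in>I. r j w)"
    by (intro cINF_greatest[OF ne]) (simp add: algebra_simps)
  then show "(INF i\<in>I. r i (z + w)) \<le> (INF i\<in>I. r i z) + (INF i\<in>I. r i w)"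
    by simp
next
  fix c :: real and z
  assume c: "c \<ge> 0"
  have le: "(INF i\<in>I. r i (c *\<^sub>R z)) \<le> c * r i z" if i: "i \<in> I" for i
  proof -
    obtain k where "k \<in> I" "r k (c *\<^sub>R z) \<le> c * r i z"
      using scale[OF i c] by blast
    then show ?thesis by (rule cINF_lower2[OF bdd])
  qed
  show "(INF i\<in>I. r i (c *\<^sub>R z)) \<le> c * (INF i\<in>I. r i z)"
  proof (cases "c = 0")
    case True
    then show ?thesis using le ne by auto
  next
    case False
    then have pos: "c > 0" using c by simp
    have "(INF i\<in>I. r i (c *\<^sub>R z)) / c \<le> (INF i\<in>I. r i z)"
      using le pos by (intro cINF_greatest[OF ne]) (simp add: field_simps)
    then show ?thesis using pos by (simp add: field_simps)
  qed
qed

text \<open>Pushing a sublinear functional down in the direction \<open>v\<close>: the infimum is still sublinear,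
  and a linear functional below it takes at \<open>t *\<^sub>R v\<close> at least the prescribed value \<open>t * c\<close>, for
  each \<open>t\<close> in the cone \<open>T\<close>. With \<open>T\<close> the half-line this bounds the value at \<open>v\<close> from below; with
  \<open>T\<close> the whole line it fixes that value.\<close>

lemma sublinear_shift:
  fixes p :: "'a::real_vector \<Rightarrow> real" and T :: "real set"
  assumes p: "sublinear p"
    and T0: "0 \<in> T"
    and Tadd: "\<And>s t. s \<in> T \<Longrightarrow> t \<in> T \<Longrightarrow> s + t \<in> T"
    and Tscale: "\<And>a t. a \<ge> 0 \<Longrightarrow> t \<in> T \<Longrightarrow> a * t \<in> T"
    and dom: "\<And>t. t \<in> T \<Longrightarrow> t * c \<le> p (t *\<^sub>R v)"
  defines "q \<equiv> \<lambda>z. INF t\<in>T. p (z + t *\<^sub>R v) - t * c"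
  shows sublinear_shift_sublinear: "sublinear q"
    and sublinear_shift_le: "t \<in> T \<Longrightarrow> q z \<le> p (z + t *\<^sub>R v) - t * c"
proof -
  have bdd: "bdd_below ((\<lambda>t. p (z + t *\<^sub>R v) - t * c) ` T)" for z
  proof (rule bdd_belowI2)
    fix t assume "t \<in> T"
    then show "- p (- z) \<le> p (z + t *\<^sub>R v) - t * c"
      using dom[of t] sublinear_add[OF p, of "z + t *\<^sub>R v" "- z"] by simp
  qed
  show "q z \<le> p (z + t *\<^sub>R v) - t * c" if "t \<in> T"
    unfolding q_def by (rule cINF_lower[OF bdd that])
  show "sublinear q"
    unfolding q_def
  proof (rule sublinear_INF[OF _ bdd])
    show "T \<noteq> {}" using T0 by blast
  next
    fix s t z w
    assume st: "s \<in> T" "t \<in> T"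
    have "p ((z + w) + (s + t) *\<^sub>R v) \<le> p (z + s *\<^sub>R v) + p (w + t *\<^sub>R v)"
      using sublinear_add[OF p, of "z + s *\<^sub>R v" "w + t *\<^sub>R v"] by (simp add: algebra_simps)
    then show "\<exists>k\<in>T. p (z + w + k *\<^sub>R v) - k * c
        \<le> (p (z + s *\<^sub>R v) - s * c) + (p (w + t *\<^sub>R v) - t * c)"
      by (intro bexI[of _ "s + t"] Tadd st) (simp add: algebra_simps)
  next
    fix t a :: real and z
    assume t: "t \<in> T" and a: "a \<ge> 0"
    have "p (a *\<^sub>R z + (a * t) *\<^sub>R v) \<le> a * p (z + t *\<^sub>R v)"
      using sublinear_scaleR_le[OF p a, of "z + t *\<^sub>R v"] by (simp add: algebra_simps)
    then show "\<exists>k\<in>T. p (a *\<^sub>R z + k *\<^sub>R v) - k * c \<le> a * (p (z + t *\<^sub>R v) - t * c)"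
      by (intro bexI[of _ "a * t"] Tscale t a) (simp add: algebra_simps)
  qed
qed

text \<open>The lower bound \<open>- p (- z)\<close>, common to all sublinear functionals below \<open>p\<close>, keeps the infima
  over chains finite, so that Zorn's lemma applies.\<close>

lemma ex_minimal_sublinear_le:
  assumes p: "sublinear p"
  obtains m where "sublinear m" "m \<le> p" "\<And>q. sublinear q \<Longrightarrow> q \<le> m \<Longrightarrow> q = m"
proof -
  let ?A = "{q. sublinear q \<and> q \<le> p}"
  have "\<exists>m\<in>?A. \<forall>q\<in>?A. q \<le> m \<longrightarrow> q = m"
  proof (rule predicate_Zorn)
    show "partial_order_on ?A (relation_of (\<lambda>f g. g \<le> f) ?A)"
      by (rule partial_order_on_relation_ofI) auto
  next
    fix C assume C: "C \<in> Chains (relation_of (\<lambda>f g. g \<le> f) ?A)"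
    then have CA: "C \<subseteq> ?A" by (rule Chains_relation_of)
    have total: "f \<le> g \<or> g \<le> f" if "f \<in> C" "g \<in> C" for f g
      using C that by (auto simp: Chains_def relation_of_def)
    show "\<exists>u\<in>?A. \<forall>a\<in>C. u \<le> a"
    proof (cases "C = {}")
      case True
      then show ?thesis using p by auto
    next
      case False
      have bdd: "bdd_below ((\<lambda>f. f z) ` C)" for z
      proof (rule bdd_belowI2)
        fix f assume "f \<in> C"
        then have "sublinear f" "f (- z) \<le> p (- z)" using CA by (auto simp: le_fun_def)
        then show "- p (- z) \<le> f z" using sublinear_ge_neg[of f z] by simp
      qed
      let ?u = "\<lambda>z. INF f\<in>C. f z"
      have below: "?u \<le> f" if "f \<in> C" for f
        using cINF_lower[OF bdd that] by (simp add: le_fun_def)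
      have "sublinear ?u"
      proof (rule sublinear_INF[OF False bdd])
        fix f g z w assume fg: "f \<in> C" "g \<in> C"
        then have sub: "sublinear f" "sublinear g" using CA by auto
        \<comment> \<open>The smaller of the two functionals serves as the common index.\<close>
        show "\<exists>k\<in>C. k (z + w) \<le> f z + g w"
          using total[OF fg]
        proof
          assume "f \<le> g"
          then have "f w \<le> g w" by (simp add: le_fun_def)
          then show ?thesis using sublinear_add[OF sub(1), of z w] fg by (intro bexI[of _ f]) auto
        next
          assume "g \<le> f"
          then have "g z \<le> f z" by (simp add: le_fun_def)
          then show ?thesis using sublinear_add[OF sub(2), of z w] fg by (intro bexI[of _ g]) auto
        qed
      next
        fix f z and c :: real assume "f \<in> C" "c \<ge> 0"
        then show "\<exists>k\<in>C. k (c *\<^sub>R z) \<le> c * f z"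
          using CA sublinear_scaleR_le by blast
      qed
      moreover have "?u \<le> p" using False CA below by (blast intro: order_trans)
      ultimately show ?thesis using below by blast
    qed
  qed
  then show thesis using that by (blast intro: order_trans)
qed

text \<open>Shifting a minimal sublinear functional \<open>m\<close> along the half-line of \<open>y\<close>, with value \<open>m y\<close>,
  cannot lower it. This says \<open>m x \<le> m (x + y) - m y\<close>, the missing half of additivity.\<close>

lemma minimal_sublinear_linear:
  assumes m: "sublinear m" and min: "\<And>q. sublinear q \<Longrightarrow> q \<le> m \<Longrightarrow> q = m"
  shows "linear m"
proof -
  have add: "m (x + y) = m x + m y" for x y
  proof -
    define q where "q \<equiv> \<lambda>z. INF t\<in>{0..}. m (z + t *\<^sub>R y) - t * m y"
    have dom: "t * m y \<le> m (t *\<^sub>R y)" if "t \<in> {0..}" for t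
      using sublinear_scaleR[OF m, of t y] that by simp
    have q: "sublinear q"
      unfolding q_def by (rule sublinear_shift_sublinear[OF m]) (auto intro: dom)
    have q_le: "q z \<le> m (z + t *\<^sub>R y) - t * m y" if "t \<ge> 0" for z t
      unfolding q_def by (rule sublinear_shift_le[OF m]) (use that in \<open>auto intro: dom\<close>)
    have "q \<le> m" using q_le[of 0] by (simp add: le_fun_def)
    then have "q = m" by (rule min[OF q])
    then have "m x \<le> m (x + y) - m y" using q_le[of 1 x] by simp
    then show ?thesis using sublinear_add[OF m, of x y] by simp
  qed
  have neg: "m (- x) = - m x" for x
    using add[of x "- x"] sublinear_zero[OF m] by simp
  have "m (c *\<^sub>R x) = c *\<^sub>R m x" for c x
  proof (cases "c \<ge> 0")
    case True
    then show ?thesis using sublinear_scaleR[OF m] by simp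
  next
    case False
    then have "m (- (c *\<^sub>R x)) = (- c) * m x" using sublinear_scaleR[OF m, of "- c" x] by simp
    then show ?thesis using neg[of "c *\<^sub>R x"] by simp
  qed
  then show ?thesis using add by (intro linearI)
qed

text \<open>To make the linear functional touch \<open>p\<close> at \<open>x\<close>, first push \<open>p\<close> down along the half-line of
  \<open>x\<close>; every linear functional below the result is at least \<open>p x\<close> at \<open>x\<close>.\<close>

theorem hahn_banach_support:
  fixes p :: "'a::real_vector \<Rightarrow> real"
  assumes p: "sublinear p"
  obtains f where "linear f" "f \<le> p" "f x = p x"
proof -
  define q where "q \<equiv> \<lambda>z. INF t\<in>{0..}. p (z + t *\<^sub>R x) - t * p x"
  have dom: "t * p x \<le> p (t *\<^sub>R x)" if "t \<in> {0..}" for t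
    using sublinear_scaleR[OF p, of t x] that by simp
  have q: "sublinear q"
    unfolding q_def by (rule sublinear_shift_sublinear[OF p]) (auto intro: dom)
  have q_le: "q z \<le> p (z + t *\<^sub>R x) - t * p x" if "t \<ge> 0" for z t
    unfolding q_def by (rule sublinear_shift_le[OF p]) (use that in \<open>auto intro: dom\<close>)
  obtain f where f: "sublinear f" "f \<le> q" "\<And>g. sublinear g \<Longrightarrow> g \<le> f \<Longrightarrow> g = f"
    using ex_minimal_sublinear_le[OF q] by blast
  then have lin: "linear f" by (intro minimal_sublinear_linear)
  have "f z \<le> p z" for z
    using f(2) q_le[of 0 z] by (auto simp: le_fun_def intro: order_trans)
  then have fp: "f \<le> p" by (simp add: le_fun_def)
  have "f (- x) \<le> q (- x)" using f(2) by (simp add: le_fun_def)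
  also have "\<dots> \<le> - p x" using q_le[of 1 "- x"] sublinear_zero[OF p] by simp
  finally have "p x \<le> f x" using linear_neg[OF lin, of x] by simp
  then have "f x = p x" using fp by (simp add: le_fun_def order_antisym)
  then show thesis using that lin fp by blast
qed

section \<open>Orthogonality through support functionals\<close>

text \<open>Orthogonality says that \<open>x\<close> is a point of its line in direction \<open>y\<close> closest to the origin, so
  its norm does not drop in the quotient by the span of \<open>y\<close>. Hahn--Banach for this quotient
  seminorm gives the functional.\<close>

theorem birkhoff_james_iff_support_functional:
  fixes x y :: "'a::real_normed_vector"
  assumes x: "x \<noteq> 0"
  shows "x \<bottom>\<^sub>B y \<longleftrightarrow>
    (\<exists>f :: 'a \<Rightarrow>\<^sub>L real. norm f = 1 \<and> blinfun_apply f x = norm x \<and> blinfun_apply f y = 0)"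
proof
  assume orth: "x \<bottom>\<^sub>B y"
  define q where "q \<equiv> \<lambda>z. INF t\<in>UNIV. norm (z + t *\<^sub>R y) - t * 0"
  have q: "sublinear q"
    unfolding q_def by (rule sublinear_shift_sublinear[OF sublinear_norm]) auto
  have q_le: "q z \<le> norm (z + t *\<^sub>R y)" for z t
    using sublinear_shift_le[OF sublinear_norm, of UNIV 0 y t z] by (simp add: q_def)
  have "norm x \<le> q x"
    unfolding q_def by (rule cINF_greatest) (use orth in \<open>auto simp: birkhoff_james_orthogonal_def\<close>)
  then have qx: "q x = norm x" using q_le[of x 0] by simp
  obtain f where f: "linear f" "f \<le> q" "f x = q x"
    using hahn_banach_support[OF q] by blast
  have f_le: "f z \<le> norm (z + t *\<^sub>R y)" for z t
    using f(2) q_le[of z t] by (auto simp: le_fun_def intro: order_trans)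
  have bound: "norm (f z) \<le> norm z * 1" for z
    using f_le[of z 0] f_le[of "- z" 0] linear_neg[OF f(1), of z] by simp
  have bl: "bounded_linear f"
    by (rule bounded_linear_intro[OF linear_add[OF f(1)] linear_scale[OF f(1)] bound])
  have fy: "f y = 0"
    using f_le[of y "- 1"] f_le[of "- y" 1] linear_neg[OF f(1), of y] by simp
  define F where "F = Blinfun f"
  have F: "blinfun_apply F = f" unfolding F_def by (rule bounded_linear_Blinfun_apply[OF bl])
  have "norm F \<le> 1" by (rule norm_blinfun_bound) (use bound F in auto)
  moreover have "norm x \<le> norm F * norm x"
    using norm_blinfun[of F x] f(3) qx F by simp
  then have "1 \<le> norm F" using x by simp
  ultimately show "\<exists>f :: 'a \<Rightarrow>\<^sub>L real.
      norm f = 1 \<and> blinfun_apply f x = norm x \<and> blinfun_apply f y = 0"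
    using f(3) qx fy F by (intro exI[of _ F]) auto
next
  assume "\<exists>f :: 'a \<Rightarrow>\<^sub>L real.
    norm f = 1 \<and> blinfun_apply f x = norm x \<and> blinfun_apply f y = 0"
  then obtain f :: "'a \<Rightarrow>\<^sub>L real"
    where f: "norm f = 1" "blinfun_apply f x = norm x" "blinfun_apply f y = 0" by blast
  have "norm x \<le> norm (x + c *\<^sub>R y)" for c
    using norm_blinfun[of f "x + c *\<^sub>R y"] f by (simp add: blinfun.add_right blinfun.scaleR_right)
  then show "x \<bottom>\<^sub>B y" by (simp add: birkhoff_james_orthogonal_def)
qed

lemma ex_support_functional:
  fixes x :: "'a::real_normed_vector"
  assumes "x \<noteq> 0"
  shows "\<exists>f :: 'a \<Rightarrow>\<^sub>L real. norm f = 1 \<and> blinfun_apply f x = norm x"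
proof -
  have "x \<bottom>\<^sub>B 0" by (simp add: birkhoff_james_orthogonal_def)
  then show ?thesis using birkhoff_james_iff_support_functional[OF assms] by blast
qed

section \<open>Smoothness and preservation of orthogonality\<close>

lemma smooth_imp_norm_attaining_preserves_orthogonality:
  fixes T :: "'a::real_normed_vector \<Rightarrow>\<^sub>L 'b::real_normed_vector"
  assumes smooth: "smooth_space TYPE('a)"
    and x: "x \<in> norm_attainment_set T"
    and orth: "x \<bottom>\<^sub>B y"
  shows "blinfun_apply T x \<bottom>\<^sub>B blinfun_apply T y"
proof (cases "T = 0")
  case True
  then show ?thesis by (simp add: birkhoff_james_orthogonal_def)
next
  case False
  have nx: "norm x = 1" and nTx: "norm (blinfun_apply T x) = norm T"
    using x by (auto simp: norm_attainment_set_def)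
  have x0: "x \<noteq> 0" and Tx0: "blinfun_apply T x \<noteq> 0" using nx nTx False by auto
  obtain g :: "'b \<Rightarrow>\<^sub>L real"
    where g: "norm g = 1" "blinfun_apply g (blinfun_apply T x) = norm T"
    using ex_support_functional[OF Tx0] nTx by auto
  obtain h :: "'a \<Rightarrow>\<^sub>L real"
    where h: "norm h = 1" "blinfun_apply h x = 1" "blinfun_apply h y = 0"
    using birkhoff_james_iff_support_functional[OF x0] orth nx by auto
  define f where "f = (1 / norm T) *\<^sub>R (g o\<^sub>L T)"
  have fx: "blinfun_apply f x = 1" using g False by (simp add: f_def blinfun.scaleR_left)
  have "norm f \<le> 1"
    using norm_blinfun_compose[of g T] g False by (simp add: f_def field_simps)
  moreover have "1 \<le> norm f" using norm_blinfun[of f x] fx nx by simp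
  ultimately have "f = h" using smooth nx fx h unfolding smooth_space_def by force
  then have "blinfun_apply f y = 0" using h(3) by simp
  then have "blinfun_apply g (blinfun_apply T y) = 0"
    using False by (simp add: f_def blinfun.scaleR_left)
  then show ?thesis
    using birkhoff_james_iff_support_functional[OF Tx0] g nTx by auto
qed

lemma orthogonal_scaleR_self_iff:
  fixes x :: "'a::real_normed_vector"
  assumes "x \<noteq> 0"
  shows "x \<bottom>\<^sub>B a *\<^sub>R x \<longleftrightarrow> a = 0"
proof
  assume "x \<bottom>\<^sub>B a *\<^sub>R x"
  then have "norm x \<le> norm (x + (- 1 / a) *\<^sub>R (a *\<^sub>R x))"
    unfolding birkhoff_james_orthogonal_def by blast
  then show "a = 0" using assms by (cases "a = 0") auto
qed (simp add: birkhoff_james_orthogonal_def)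

lemma preserves_orthogonality_imp_support_functional_unique:
  fixes x :: "'a::real_normed_vector" and f g :: "'a \<Rightarrow>\<^sub>L real"
  assumes pres: "\<And>(T :: 'a \<Rightarrow>\<^sub>L 'a) y.
      x \<in> norm_attainment_set T \<Longrightarrow> x \<bottom>\<^sub>B y \<Longrightarrow> blinfun_apply T x \<bottom>\<^sub>B blinfun_apply T y"
    and nx: "norm x = 1"
    and f: "norm f = 1" "blinfun_apply f x = 1"
    and g: "norm g = 1" "blinfun_apply g x = 1"
  shows "f = g"
proof (rule blinfun_eqI)
  fix z
  have x0: "x \<noteq> 0" using nx by auto
  \<comment> \<open>The projection of \<open>z\<close> to the kernel of \<open>f\<close> along \<open>x\<close>.\<close>
  define y where "y = z - blinfun_apply f z *\<^sub>R x"
  have fy: "blinfun_apply f y = 0"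
    using f by (simp add: y_def blinfun.diff_right blinfun.scaleR_right)
  have gy: "blinfun_apply g y = blinfun_apply g z - blinfun_apply f z"
    using g by (simp add: y_def blinfun.diff_right blinfun.scaleR_right)
  have orth: "x \<bottom>\<^sub>B y"
    using birkhoff_james_iff_support_functional[OF x0] f fy nx by auto
  define T where "T = blinfun_scaleR_left x o\<^sub>L g"
  have T: "blinfun_apply T w = blinfun_apply g w *\<^sub>R x" for w by (simp add: T_def)
  have "norm T \<le> 1"
    using norm_blinfun[of g] g nx by (intro norm_blinfun_bound) (auto simp: T)
  moreover have "1 \<le> norm T" using norm_blinfun[of T x] g nx by (simp add: T)
  ultimately have "x \<in> norm_attainment_set T"
    using g nx by (simp add: norm_attainment_set_def T)
  then have "x \<bottom>\<^sub>B blinfun_apply g y *\<^sub>R x" using pres[of T y] orth g by (simp add: T)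
  then show "blinfun_apply f z = blinfun_apply g z"
    using orthogonal_scaleR_self_iff[OF x0] gy by simp
qed

theorem theorem2p6:
  shows "smooth_space TYPE('a::banach) \<longleftrightarrow>
    (\<forall>T :: 'a \<Rightarrow>\<^sub>L 'a. \<forall>x \<in> norm_attainment_set T.
       blinfun_apply T ` bj_perp x \<subseteq> bj_perp (blinfun_apply T x))"
proof
  assume "smooth_space TYPE('a)"
  then show "\<forall>T :: 'a \<Rightarrow>\<^sub>L 'a. \<forall>x \<in> norm_attainment_set T.
       blinfun_apply T ` bj_perp x \<subseteq> bj_perp (blinfun_apply T x)"
    using smooth_imp_norm_attaining_preserves_orthogonality by (fastforce simp: bj_perp_def)
next
  assume pres: "\<forall>T :: 'a \<Rightarrow>\<^sub>L 'a. \<forall>x \<in> norm_attainment_set T.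
       blinfun_apply T ` bj_perp x \<subseteq> bj_perp (blinfun_apply T x)"
  show "smooth_space TYPE('a)"
    unfolding smooth_space_def
  proof
    fix x :: 'a assume "x \<in> sphere 0 1"
    then have nx: "norm x = 1" by simp
    then have "x \<noteq> 0" by auto
    then obtain f :: "'a \<Rightarrow>\<^sub>L real" where f: "norm f = 1" "blinfun_apply f x = 1"
      using ex_support_functional nx by metis
    show "\<exists>!f :: 'a \<Rightarrow>\<^sub>L real. norm f = 1 \<and> blinfun_apply f x = 1"
    proof (rule ex1I[of _ f])
      fix g :: "'a \<Rightarrow>\<^sub>L real" assume "norm g = 1 \<and> blinfun_apply g x = 1"
      then show "g = f"
        using pres nx f
        by (intro preserves_orthogonality_imp_support_functional_unique[of x])
          (auto simp: bj_perp_def)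
    qed (use f in simp)
  qed
qed

end
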